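(* Let $d \ge 1$, let $G$ be the disjoint union of $2d-1$ copies of the complete bipartite graph $K_{d,d}$, and let $\mathcal{P} = \{V_1, \ldots, V_{2d}\}$ be a partition of $V(G)$ such that $|V_i| = 2d-1$ for every $i$ and $G$ has no independent transversal with respect to $\mathcal{P}$. Then $G, \mathcal{P}$ can be derived by starting from a copy of $K_{d,d}$ with its standard bipartition and iteratively adding copies of $K_{d,d}$ with the standard bipartition via join steps (as defined in the context).
   Context: For a graph $G$ and a partition $\mathcal{P} = \{V_1, \ldots, V_r\}$ of $V(G)$ into blocks, an independent transversal (IT) of $G$ with respect to $\mathcal{P}$ is an independent set $\{v_1, \ldots, v_r\}$ of $G$ with $v_i \in V_i$ for every $i$. The standard bipartition of a complete bipartite graph $K_{A,B}$ with parts $A,B$ is the vertex partition $\{A,B\}$. Join step: given a current vertex-partitioned graph $(H, \mathcal{Q})$, a block $W \in \mathcal{Q}$, and a copy $K_{A,B}$ of $K_{d,d}$ (so $|A|=|B|=d$) disjoint from $H$, form the graph $H \cup K_{A,B}$ (disjoint union) with vertex partition $(\mathcal{Q} \setminus \{W\}) \cup \{A', B'\}$, where $A' \supseteq A$ and $B' \supseteq B$ are obtained by distributing each vertex of $W$ into exactly one of $A$, $B$ arbitrarily. *)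

theory Defs
  imports Main "HOL-Library.Disjoint_Sets"
begin

record 'a sgraph =
  verts :: "'a set"
  edges :: "'a set set"

text \<open>The complete bipartite graph with parts \<open>A\<close> and \<open>B\<close>; it is only meaningful for
  disjoint \<open>A\<close> and \<open>B\<close>, which \<open>Kdd_parts\<close> guarantees.\<close>

definition complete_bipartite :: "'a set \<Rightarrow> 'a set \<Rightarrow> 'a sgraph" where
  "complete_bipartite A B =
     \<lparr>verts = A \<union> B, edges = {{a, b} | a b. a \<in> A \<and> b \<in> B}\<rparr>"

definition Kdd_parts :: "nat \<Rightarrow> 'a set \<Rightarrow> 'a set \<Rightarrow> bool" where
  "Kdd_parts d A B \<longleftrightarrow>
     finite A \<and> finite B \<and> card A = d \<and> card B = d \<and> A \<inter> B = {}"

definition graph_union :: "'a sgraph \<Rightarrow> 'a sgraph \<Rightarrow> 'a sgraph" where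
  "graph_union G H = \<lparr>verts = verts G \<union> verts H, edges = edges G \<union> edges H\<rparr>"

definition disjoint_union_of_Kdd :: "nat \<Rightarrow> nat \<Rightarrow> 'a sgraph \<Rightarrow> bool" where
  "disjoint_union_of_Kdd n d G \<longleftrightarrow>
     (\<exists>A B. (\<forall>i<n. Kdd_parts d (A i) (B i)) \<and>
            disjoint_family_on (\<lambda>i. verts (complete_bipartite (A i) (B i))) {..<n} \<and>
            G = \<lparr>verts = (\<Union>i<n. verts (complete_bipartite (A i) (B i))),
                 edges = (\<Union>i<n. edges (complete_bipartite (A i) (B i)))\<rparr>)"

definition independent_set :: "'a sgraph \<Rightarrow> 'a set \<Rightarrow> bool" where
  "independent_set G S \<longleftrightarrow> S \<subseteq> verts G \<and> (\<forall>x\<in>S. \<forall>y\<in>S. {x, y} \<notin> edges G)"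

text \<open>The chosen vertices are indexed by the blocks themselves: \<open>v W\<close> is the vertex
  chosen from the block \<open>W\<close>.\<close>

definition independent_transversal :: "'a sgraph \<Rightarrow> 'a set set \<Rightarrow> 'a set \<Rightarrow> bool" where
  "independent_transversal G P S \<longleftrightarrow>
     independent_set G S \<and> (\<exists>v. (\<forall>W\<in>P. v W \<in> W) \<and> S = v ` P)"

text \<open>In a join step, \<open>X\<close> and \<open>Y\<close> are the vertices of the block \<open>W\<close> that are added to
  \<open>A\<close> and \<open>B\<close> respectively; either of them may be empty.\<close>

inductive join_step ::
  "nat \<Rightarrow> 'a sgraph \<times> 'a set set \<Rightarrow> 'a sgraph \<times> 'a set set \<Rightarrow> bool" for d where
  "\<lbrakk>W \<in> Q; Kdd_parts d A B; verts (complete_bipartite A B) \<inter> verts H = {};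
    X \<union> Y = W; X \<inter> Y = {}\<rbrakk> \<Longrightarrow>
   join_step d (H, Q)
     (graph_union H (complete_bipartite A B), (Q - {W}) \<union> {A \<union> X, B \<union> Y})"

inductive derivable :: "nat \<Rightarrow> 'a sgraph \<times> 'a set set \<Rightarrow> bool" for d where
  start: "Kdd_parts d A B \<Longrightarrow> derivable d (complete_bipartite A B, {A, B})"
| join: "\<lbrakk>derivable d HQ; join_step d HQ HQ'\<rbrakk> \<Longrightarrow> derivable d HQ'"

end

theory Submission
  imports Defs
begin

text \<open>Read every copy of \<open>K\<^bsub>d,d\<^esub>\<close> as a Boolean variable (which of its two sides may be used by
  a transversal) and every block as the clause of the sides it meets. As blocks are disjoint, an
  independent transversal is the same as a satisfying assignment. Counting vertices shows that the
  \<open>2d\<close> clauses in \<open>2d - 1\<close> variables are minimally unsatisfiable. A minimally unsatisfiable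
  formula has more clauses than variables (Tarsi), and if it has exactly one more, then some
  variable occurs once positively and once negatively. Resolving on that variable
  undoes a join step and preserves minimal unsatisfiability.\<close>

section \<open>Minimally unsatisfiable clause families\<close>

text \<open>The pair \<open>(x, b)\<close> is the literal demanding value \<open>b\<close> at
  \<open>x\<close>. Formulas are indexed families, so clauses that become equal when literals are
  deleted are still counted separately.\<close>

definition sat_by :: "('i \<Rightarrow> ('v \<times> bool) set) \<Rightarrow> 'i set \<Rightarrow> ('v \<Rightarrow> bool) \<Rightarrow> bool" where
  "sat_by c I s \<longleftrightarrow> (\<forall>i\<in>I. \<exists>x. (x, s x) \<in> c i)"

definition min_unsat :: "('i \<Rightarrow> ('v \<times> bool) set) \<Rightarrow> 'i set \<Rightarrow> bool" where
  "min_unsat c I \<longleftrightarrow> (\<nexists>s. sat_by c I s) \<and> (\<forall>i\<in>I. \<exists>s. sat_by c (I - {i}) s)"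

definition occ :: "('i \<Rightarrow> ('v \<times> bool) set) \<Rightarrow> 'i set \<Rightarrow> 'v \<Rightarrow> bool \<Rightarrow> 'i set" where
  "occ c I x b = {i \<in> I. (x, b) \<in> c i}"

lemma finite_occ [simp]: "finite I \<Longrightarrow> finite (occ c I x b)"
  by (simp add: occ_def)

lemma min_unsat_subset_exists:
  assumes "finite I" "\<nexists>s. sat_by c I s"
  obtains K where "K \<subseteq> I" "min_unsat c K"
proof -
  let ?P = "\<lambda>K. K \<subseteq> I \<and> (\<nexists>s. sat_by c K s)"
  obtain K where K: "?P K" and least: "\<And>L. ?P L \<Longrightarrow> card K \<le> card L"
    using ex_has_least_nat[of ?P I card] assms by blast
  have "\<exists>s. sat_by c (K - {i}) s" if "i \<in> K" for i
  proof (rule ccontr)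
    assume "\<not> ?thesis"
    with K have "card K \<le> card (K - {i})" by (intro least) blast
    moreover have "card (K - {i}) < card K"
      using that K assms(1) by (intro card_Diff1_less) (auto dest: finite_subset)
    ultimately show False by simp
  qed
  with K show thesis by (intro that[of K]) (auto simp: min_unsat_def)
qed

text \<open>A clause with both literals of \<open>x\<close> holds under every assignment, so
  whatever satisfies the remaining clauses would satisfy them all.\<close>

lemma min_unsat_occ_disjoint:
  assumes "min_unsat c I"
  shows "occ c I x b \<inter> occ c I x (\<not> b) = {}"
proof (rule ccontr)
  assume "\<not> ?thesis"
  then obtain i where i: "i \<in> I" "(x, b) \<in> c i" "(x, \<not> b) \<in> c i" by (auto simp: occ_def)
  then obtain s where s: "sat_by c (I - {i}) s" using assms by (auto simp: min_unsat_def)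
  have "(x, s x) \<in> c i" using i by (cases "s x = b") auto
  with s have "sat_by c I s" by (auto simp: sat_by_def)
  with assms show False by (auto simp: min_unsat_def)
qed

text \<open>Pure literal argument: if \<open>x\<close> had a single sign, an assignment satisfying
  all clauses but \<open>i\<close> could be reset at \<open>x\<close> to satisfy \<open>i\<close> as
  well, without harming any other clause.\<close>

lemma min_unsat_occ_nonempty:
  assumes "min_unsat c I" "i \<in> occ c I x b'"
  shows "occ c I x b \<noteq> {}"
proof
  assume empty: "occ c I x b = {}"
  with assms(2) have b': "b' = (\<not> b)" by (cases "b' = b") auto
  have i: "i \<in> I" "(x, \<not> b) \<in> c i" using assms(2) b' by (auto simp: occ_def)
  then obtain s where s: "sat_by c (I - {i}) s" using assms by (auto simp: min_unsat_def)
  have "sat_by c I (s(x := \<not> b))"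
    unfolding sat_by_def
  proof
    fix j assume j: "j \<in> I"
    show "\<exists>y. (y, (s(x := \<not> b)) y) \<in> c j"
    proof (cases "j = i")
      case True
      then show ?thesis using i by (intro exI[of _ x]) simp
    next
      case False
      then obtain y where y: "(y, s y) \<in> c j" using s j by (auto simp: sat_by_def)
      have "(x, b) \<notin> c j" using empty j by (auto simp: occ_def)
      with y have "y = x \<Longrightarrow> s y = (\<not> b)" by (cases b; cases "s x"; simp)
      with y show ?thesis by (intro exI[of _ y]) auto
    qed
  qed
  with assms show False by (auto simp: min_unsat_def)
qed

section \<open>Saturation and Tarsi's bound\<close>

text \<open>Among the unsatisfiable enlargements of \<open>c\<close> with variables in
  \<open>V\<close>, one of greatest total size is saturated. Enlarging clauses keeps the assignments
  that witness minimality.\<close>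

lemma min_unsat_saturate:
  fixes c :: "'i \<Rightarrow> ('v \<times> bool) set"
  assumes "finite I" "finite V" "\<forall>i\<in>I. c i \<subseteq> V \<times> UNIV" "min_unsat c I"
  obtains c' where "\<forall>i\<in>I. c i \<subseteq> c' i" "\<forall>i\<in>I. c' i \<subseteq> V \<times> UNIV" "min_unsat c' I"
    "\<And>i x b. i \<in> I \<Longrightarrow> x \<in> V \<Longrightarrow> (x, b) \<notin> c' i \<Longrightarrow> \<exists>s. sat_by (c'(i := insert (x, b) (c' i))) I s"
proof -
  let ?P = "\<lambda>f. (\<forall>i\<in>I. c i \<subseteq> f i \<and> f i \<subseteq> V \<times> UNIV) \<and> (\<nexists>s. sat_by f I s)"
  let ?m = "\<lambda>f :: 'i \<Rightarrow> ('v \<times> bool) set. \<Sum>i\<in>I. card (f i)"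
  let ?b = "\<Sum>i\<in>I. card (V \<times> (UNIV :: bool set))"
  have "?m f < Suc ?b" if "?P f" for f
    unfolding less_Suc_eq_le using that assms(2) by (intro sum_mono card_mono) auto
  then have bounded: "\<forall>f. ?P f \<longrightarrow> ?m f < Suc ?b" by simp
  have "?P c" using assms by (auto simp: min_unsat_def)
  then have "\<exists>f. ?P f \<and> (\<forall>g. ?P g \<longrightarrow> ?m g \<le> ?m f)"
    using bounded by (rule ex_has_greatest_nat[of ?P c ?m "Suc ?b"])
  then obtain f where f: "?P f" and greatest: "\<And>g. ?P g \<Longrightarrow> ?m g \<le> ?m f"
    by (elim exE conjE) simp
  have "min_unsat f I"
    unfolding min_unsat_def
  proof (intro conjI ballI)
    fix i assume "i \<in> I"
    then obtain s where "sat_by c (I - {i}) s" using assms by (auto simp: min_unsat_def)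
    then have "sat_by f (I - {i}) s" using f unfolding sat_by_def by blast
    then show "\<exists>s. sat_by f (I - {i}) s" by (rule exI[of _ s])
  qed (use f in blast)
  moreover have "\<exists>s. sat_by (f(i := insert (x, b) (f i))) I s"
    if "i \<in> I" "x \<in> V" "(x, b) \<notin> f i" for i x b
  proof (rule ccontr)
    let ?g = "f(i := insert (x, b) (f i))"
    assume "\<not> ?thesis"
    moreover have "\<forall>k\<in>I. c k \<subseteq> ?g k \<and> ?g k \<subseteq> V \<times> UNIV" using f that by auto
    ultimately have "?m ?g \<le> ?m f" by (intro greatest conjI)
    moreover have "f i \<subseteq> V \<times> UNIV" using f that by blast
    then have "finite (f i)" by (rule finite_subset) (simp add: assms(2))
    then have "?m f < ?m ?g" using that assms(1) by (intro sum_strict_mono_ex1) auto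
    ultimately show False by simp
  qed
  ultimately show thesis using f by (intro that[of f]) blast+
qed

text \<open>In the saturated formula, setting \<open>x\<close> to \<open>b\<close> leaves a minimally unsatisfiable formula. If \<open>x\<close>
  has the fewest occurrences, every other variable survives this, so the induction hypothesis
  bounds the number of clauses that do not contain \<open>(x, b)\<close> from below.\<close>

lemma min_unsat_card:
  assumes "finite V" "finite I" "\<forall>i\<in>I. c i \<subseteq> V \<times> UNIV" "min_unsat c I"
    and "\<forall>x\<in>V. \<exists>b. occ c I x b \<noteq> {}"
  shows "card V < card I \<and>
    (V \<noteq> {} \<and> card I = Suc (card V) \<longrightarrow> (\<exists>x\<in>V. \<forall>b. card (occ c I x b) = 1))"
  using assms
proof (induction "card V" arbitrary: V I c)
  case 0
  then have "I \<noteq> {}" by (auto simp: min_unsat_def sat_by_def)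
  with 0 show ?case by (simp add: card_gt_0_iff)
next
  case (Suc n)
  obtain f where sub: "\<forall>i\<in>I. c i \<subseteq> f i" and fV: "\<forall>i\<in>I. f i \<subseteq> V \<times> UNIV" and mu: "min_unsat f I"
    and satur: "\<And>i x b. i \<in> I \<Longrightarrow> x \<in> V \<Longrightarrow> (x, b) \<notin> f i \<Longrightarrow>
                  \<exists>s. sat_by (f(i := insert (x, b) (f i))) I s"
    using min_unsat_saturate[of I V c] Suc.prems by metis
  have occ_sub: "occ c I x b \<subseteq> occ f I x b" for x b using sub by (auto simp: occ_def)
  have c_ne: "occ c I x b \<noteq> {}" if "x \<in> V" for x b
    using min_unsat_occ_nonempty[OF Suc.prems(4)] Suc.prems(5) that by blast
  have ne: "occ f I x b \<noteq> {}" if "x \<in> V" for x b using c_ne[OF that] occ_sub by blast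
  let ?occs = "\<lambda>x. card (occ f I x True \<union> occ f I x False)"
  have "V \<noteq> {}" using Suc.hyps(2) by auto
  then obtain x where x: "x \<in> V" and least: "\<And>y. y \<in> V \<Longrightarrow> ?occs x \<le> ?occs y"
    using ex_has_least_nat[of "\<lambda>x. x \<in> V" _ ?occs] by blast
  have bound: "n < card (I - occ f I x b)" for b
  proof -
    \<comment> \<open>Setting \<open>x\<close> to \<open>b\<close> makes the clauses outside
      \<open>?J\<close> true; \<open>?g\<close> drops the literals of \<open>x\<close> from those
      that remain.\<close>
    let ?J = "I - occ f I x b" and ?g = "\<lambda>i. f i - {x} \<times> UNIV"
    have "min_unsat ?g ?J"
      unfolding min_unsat_def
    proof (intro conjI ballI notI)
      assume "\<exists>s. sat_by ?g ?J s"
      then obtain s where s: "sat_by ?g ?J s" ..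
      have "sat_by f I (s(x := b))"
        unfolding sat_by_def
      proof
        fix i assume i: "i \<in> I"
        show "\<exists>y. (y, (s(x := b)) y) \<in> f i"
        proof (cases "i \<in> occ f I x b")
          case True
          then show ?thesis by (intro exI[of _ x]) (auto simp: occ_def)
        next
          case False
          then obtain y where "(y, s y) \<in> f i" "y \<noteq> x" using s i by (auto simp: sat_by_def)
          then show ?thesis by (intro exI[of _ y]) auto
        qed
      qed
      with mu show False by (auto simp: min_unsat_def)
    next
      fix i assume i: "i \<in> ?J"
      then have "(x, b) \<notin> f i" by (auto simp: occ_def)
      with i x satur obtain s where s: "sat_by (f(i := insert (x, b) (f i))) I s" by blast
      \<comment> \<open>The assignment \<open>s\<close> satisfies the enlarged formula but not
        \<open>f\<close>, so the added literal \<open>(x, b)\<close> must be true under it.\<close>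
      have "\<not> sat_by f I s" using mu by (auto simp: min_unsat_def)
      with s have sx: "s x = b"
        unfolding sat_by_def by (metis fun_upd_apply insert_iff prod.inject)
      have "sat_by ?g (?J - {i}) s"
        unfolding sat_by_def
      proof
        fix j assume j: "j \<in> ?J - {i}"
        then obtain y where y: "(y, s y) \<in> f j" using s by (auto simp: sat_by_def)
        moreover have "y \<noteq> x" using y j sx by (auto simp: occ_def)
        ultimately show "\<exists>y. (y, s y) \<in> ?g j" by auto
      qed
      then show "\<exists>s. sat_by ?g (?J - {i}) s" by (rule exI[of _ s])
    qed
    moreover have "\<exists>b'. occ ?g ?J y b' \<noteq> {}" if y: "y \<in> V - {x}" for y
    proof (rule ccontr)
      assume none: "\<not> ?thesis"
      \<comment> \<open>If \<open>y\<close> disappeared, every clause with \<open>y\<close> would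
        contain \<open>(x, b)\<close>. Since \<open>(x, \<not> b)\<close> occurs too, and in other
        clauses, \<open>y\<close> would occur in fewer clauses than \<open>x\<close>.\<close>
      have "occ f I y b' \<subseteq> occ f I x b" for b'
      proof
        fix i assume i: "i \<in> occ f I y b'"
        show "i \<in> occ f I x b"
        proof (rule ccontr)
          assume "i \<notin> occ f I x b"
          then have "i \<in> occ ?g ?J y b'" using i y by (auto simp: occ_def)
          with none show False by blast
        qed
      qed
      then have "?occs y \<le> card (occ f I x b)"
        using Suc.prems(2) by (intro card_mono) auto
      also have "\<dots> < card (occ f I x b \<union> occ f I x (\<not> b))"
      proof (rule psubset_card_mono)
        show "occ f I x b \<subset> occ f I x b \<union> occ f I x (\<not> b)"
          using ne[OF x, of "\<not> b"] min_unsat_occ_disjoint[OF mu, of x b] by blast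
      qed (use Suc.prems(2) in auto)
      also have "occ f I x b \<union> occ f I x (\<not> b) = occ f I x True \<union> occ f I x False"
        by (cases b) auto
      finally show False using least[of y] y by simp
    qed
    moreover have "n = card (V - {x})" using Suc.hyps(2) x by simp
    moreover have "\<forall>i\<in>?J. ?g i \<subseteq> (V - {x}) \<times> UNIV" using fV by blast
    ultimately show ?thesis
      using Suc.hyps(1)[of "V - {x}" ?J ?g] Suc.prems(1,2) by simp
  qed
  have card_I: "card I = card (I - occ f I x b) + card (occ f I x b)" for b
  proof -
    have "occ f I x b \<subseteq> I" by (auto simp: occ_def)
    then show ?thesis
      using Suc.prems(2) card_mono[of I "occ f I x b"] by (simp add: card_Diff_subset finite_subset)
  qed
  have pos: "0 < card (occ c I x b)" for b
    using c_ne[OF x] Suc.prems(2) by (simp add: card_gt_0_iff)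
  have le: "card (occ c I x b) \<le> card (occ f I x b)" for b
    using Suc.prems(2) occ_sub by (intro card_mono) auto
  have "card V < card I"
    using bound[of True] card_I[of True] pos[of True] le[of True] Suc.hyps(2) by linarith
  \<comment> \<open>Here \<open>card I = n + 2\<close> and at least \<open>n + 1\<close> clauses of
    \<open>f\<close> avoid \<open>(x, b)\<close>, so at most one contains it; in \<open>c\<close> at
    least one does.\<close>
  moreover have "card (occ c I x b) = 1" if "card I = Suc (card V)" for b
    using bound[of b] card_I[of b] pos[of b] le[of b] Suc.hyps(2) that by linarith
  ultimately show ?case using x by blast
qed

section \<open>Blocks as clauses\<close>

definition side :: "('i \<Rightarrow> 'a set) \<Rightarrow> ('i \<Rightarrow> 'a set) \<Rightarrow> 'i \<Rightarrow> bool \<Rightarrow> 'a set" where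
  "side A B j b = (if b then A j else B j)"

lemma Un_eq_sides: "A j \<union> B j = (\<Union>b. side A B j b)"
  by (simp add: side_def UNIV_bool Un_commute)

definition block_clause ::
  "('i \<Rightarrow> 'a set) \<Rightarrow> ('i \<Rightarrow> 'a set) \<Rightarrow> 'i set \<Rightarrow> 'a set \<Rightarrow> ('i \<times> bool) set" where
  "block_clause A B J W = {(j, b). j \<in> J \<and> W \<inter> side A B j b \<noteq> {}}"

text \<open>An arbitrary index set, instead of the initial segment in
  \<open>disjoint_union_of_Kdd\<close>, lets the induction remove any copy.\<close>

definition bipartite_union :: "('i \<Rightarrow> 'a set) \<Rightarrow> ('i \<Rightarrow> 'a set) \<Rightarrow> 'i set \<Rightarrow> 'a sgraph" where
  "bipartite_union A B J =
     \<lparr>verts = (\<Union>j\<in>J. verts (complete_bipartite (A j) (B j))),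
      edges = (\<Union>j\<in>J. edges (complete_bipartite (A j) (B j)))\<rparr>"

lemma verts_complete_bipartite [simp]: "verts (complete_bipartite A B) = A \<union> B"
  by (simp add: complete_bipartite_def)

lemma verts_bipartite_union [simp]: "verts (bipartite_union A B J) = (\<Union>j\<in>J. A j \<union> B j)"
  by (simp add: bipartite_union_def)

lemma bipartite_union_singleton [simp]: "bipartite_union A B {j} = complete_bipartite (A j) (B j)"
  by (simp add: bipartite_union_def complete_bipartite_def)

lemma graph_union_bipartite_union:
  assumes "j \<in> J"
  shows "graph_union (bipartite_union A B (J - {j})) (complete_bipartite (A j) (B j)) =
    bipartite_union A B J"
  using assms by (auto simp: graph_union_def bipartite_union_def)

lemma block_clause_subset: "block_clause A B J W \<subseteq> J \<times> UNIV"
  by (auto simp: block_clause_def)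

lemma sides_disjoint:
  assumes "disjoint_family_on (\<lambda>j. A j \<union> B j) J" "\<forall>j\<in>J. Kdd_parts d (A j) (B j)"
    and "x \<in> side A B i a" "x \<in> side A B j b" "i \<in> J" "j \<in> J"
  shows "i = j \<and> a = b"
proof -
  have "x \<in> A i \<union> B i" "x \<in> A j \<union> B j" using assms(3,4) by (auto simp: side_def split: if_splits)
  then have "i = j" using assms(1,5,6) unfolding disjoint_family_on_def by blast
  moreover have "A j \<inter> B j = {}" using assms(2,6) by (auto simp: Kdd_parts_def)
  ultimately show ?thesis using assms(3,4) by (auto simp: side_def split: if_splits)
qed

section \<open>Undoing join steps by resolution\<close>

text \<open>With one block more than copies, some copy has each side inside a single block. Removing
  it and merging the remainders of these two blocks lowers both counts by one. The invariant does
  not mention block sizes, because merging changes them.\<close>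

lemma derivable_if_min_unsat:
  assumes "1 \<le> d" "finite J" "\<forall>j\<in>J. Kdd_parts d (A j) (B j)"
    and "disjoint_family_on (\<lambda>j. A j \<union> B j) J"
    and "partition_on (verts (bipartite_union A B J)) Q"
    and "card Q = Suc (card J)" "min_unsat (block_clause A B J) Q"
  shows "derivable d (bipartite_union A B J, Q)"
  using assms(2-)
proof (induction "card J" arbitrary: J Q)
  case 0
  \<comment> \<open>Without copies there are no vertices and so no blocks, contrary to
    \<open>card Q = 1\<close>. A single copy is handled in the successor case.\<close>
  then have "Q = {}" by (auto simp: partition_on_def)
  with 0 show ?case by simp
next
  case (Suc n)
  let ?c = "block_clause A B J"
  have finQ: "finite Q" using Suc.prems(5) card.infinite by fastforce
  have cover: "\<Union>Q = (\<Union>j\<in>J. A j \<union> B j)" and disj: "disjoint Q" and nonempty: "{} \<notin> Q"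
    using Suc.prems(4) by (auto simp: partition_on_def)
  have same: "U = U'" if "U \<in> Q" "U' \<in> Q" "v \<in> U" "v \<in> U'" for U U' v
    using disj that by (auto simp: disjoint_def)
  have side_ne: "side A B j b \<noteq> {}" if "j \<in> J" for j b
  proof -
    have "card (side A B j b) = d" using Suc.prems(2) that by (simp add: Kdd_parts_def side_def)
    with assms(1) show ?thesis by auto
  qed
  have side_cover: "side A B j b \<subseteq> \<Union>Q" if "j \<in> J" for j b
    using that cover by (auto simp: side_def)
  have "\<exists>b. occ ?c Q j b \<noteq> {}" if "j \<in> J" for j
  proof -
    obtain v where "v \<in> side A B j True" using side_ne \<open>j \<in> J\<close> by blast
    moreover then obtain W where "W \<in> Q" "v \<in> W" using side_cover \<open>j \<in> J\<close> by blast
    ultimately have "W \<in> occ ?c Q j True" using that by (auto simp: occ_def block_clause_def)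
    then show ?thesis by blast
  qed
  moreover have "J \<noteq> {}" using Suc.hyps(2) by auto
  ultimately obtain j where j: "j \<in> J" and once: "\<And>b. card (occ ?c Q j b) = 1"
    using min_unsat_card[of J Q ?c] Suc.prems(1,5,6) finQ block_clause_subset by blast
  have "\<forall>b. \<exists>W. occ ?c Q j b = {W}" using once by (auto simp: card_1_singleton_iff)
  then obtain U where U: "\<And>b. occ ?c Q j b = {U b}" by metis
  have UQ: "U b \<in> Q" for b using U[of b] by (auto simp: occ_def)
  \<comment> \<open>Blocks cover all vertices, so a side met by only one block lies inside
    it.\<close>
  have side_U: "side A B j b \<subseteq> U b" for b
  proof
    fix v assume v: "v \<in> side A B j b"
    then obtain W where W: "W \<in> Q" "v \<in> W" using side_cover j by blast
    then have "W \<in> occ ?c Q j b" using v j by (auto simp: occ_def block_clause_def)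
    with U W show "v \<in> U b" by auto
  qed
  \<comment> \<open>A block meeting both sides of copy \<open>j\<close> would be a tautological
    clause.\<close>
  have only: "b = a" if "W \<in> Q" "W \<inter> side A B j a \<noteq> {}" "W = U b" for W a b
  proof (rule ccontr)
    assume "b \<noteq> a"
    then have "b = (\<not> a)" by blast
    moreover have "W \<in> occ ?c Q j a" using that j by (auto simp: occ_def block_clause_def)
    ultimately show False
      using min_unsat_occ_disjoint[OF Suc.prems(6), of j a] U[of a] U[of "\<not> a"] that(3) by auto
  qed
  have U_neq: "U True \<noteq> U False"
    using only[of "U True" False True] side_ne[OF j, of False] side_U[of False] UQ by auto
  define X where "X = U True - A j"
  define Y where "Y = U False - B j"
  have UX: "U True = A j \<union> X" and UY: "U False = B j \<union> Y"
    using side_U[of True] side_U[of False] by (auto simp: X_def Y_def side_def)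
  have AX: "A j \<inter> X = {}" and BY: "B j \<inter> Y = {}" by (auto simp: X_def Y_def)
  have U_disj: "U True \<inter> U False = {}" using same UQ U_neq by blast
  have Kj: "Kdd_parts d (A j) (B j)" using Suc.prems(2) j by blast
  show ?case
  proof (cases "X \<union> Y = {}")
    case True
    \<comment> \<open>The two blocks are now the sides of copy \<open>j\<close>, that is, two
      contradictory unit clauses, and minimality rules out any further block.\<close>
    have "Q = {U True, U False}"
    proof (rule ccontr)
      assume "Q \<noteq> {U True, U False}"
      then obtain W where W: "W \<in> Q" "W \<noteq> U True" "W \<noteq> U False" using UQ by blast
      then obtain s where "sat_by ?c (Q - {W}) s" using Suc.prems(6) by (auto simp: min_unsat_def)
      then obtain i where i: "(i, s i) \<in> ?c (U (\<not> s j))" using UQ W unfolding sat_by_def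
        by (metis (full_types) Diff_iff singletonD)
      then obtain v where v: "v \<in> U (\<not> s j)" "v \<in> side A B i (s i)" "i \<in> J"
        by (auto simp: block_clause_def)
      moreover have "U (\<not> s j) = side A B j (\<not> s j)" using True UX UY by (auto simp: side_def)
      ultimately show False
        using sides_disjoint[OF Suc.prems(3,2), of v i "s i" j "\<not> s j"] j by auto
    qed
    moreover from this U_neq Suc.prems(5) have "card J = 1" by simp
    with j have "J = {j}" by (auto simp: card_1_singleton_iff)
    ultimately show ?thesis using True UX UY Kj by (auto intro: derivable.start)
  next
    case False
    \<comment> \<open>\<open>?W\<close> is the block that the join step will split; its clause is
      the resolvent on \<open>j\<close> of the clauses of \<open>U True\<close> and
      \<open>U False\<close>.\<close>
    let ?J = "J - {j}" and ?W = "X \<union> Y"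
    let ?c' = "block_clause A B ?J"
    let ?R = "Q - {U True, U False}"
    let ?Q = "insert ?W ?R"
    have W_notin: "?W \<notin> ?R" using False same UQ UX UY by blast
    have K_notin: "(A j \<union> B j) \<inter> \<Union>?R = {}" using same UQ UX UY by blast
    have K_W: "(A j \<union> B j) \<inter> ?W = {}"
      using U_disj AX BY UX UY by blast
    have "\<Union>Q = \<Union>?R \<union> U True \<union> U False" using UQ by blast
    also have "\<dots> = \<Union>?Q \<union> (A j \<union> B j)" unfolding Union_insert using UX UY by auto
    finally have split: "\<Union>Q = \<Union>?Q \<union> (A j \<union> B j)" .
    have "\<Union>?Q \<inter> (A j \<union> B j) = {}" using K_W K_notin unfolding Union_insert by blast
    then have "\<Union>?Q = \<Union>Q - (A j \<union> B j)" unfolding split by blast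
    also have "\<dots> = (\<Union>i\<in>?J. A i \<union> B i)"
      using Suc.prems(3) j unfolding cover disjoint_family_on_def by auto
    finally have cover': "\<Union>?Q = verts (bipartite_union A B ?J)" by simp
    have disj': "disjoint ?Q"
    proof -
      have "?W \<inter> V = {}" if "V \<in> ?R" for V using that same UQ UX UY by blast
      then show ?thesis using disj by (auto simp: disjoint_def)
    qed
    have part: "partition_on (verts (bipartite_union A B ?J)) ?Q"
      using cover' disj' nonempty False by (auto simp: partition_on_def)
    have "card {U True, U False} = 2" using U_neq by simp
    then have "card ?R = card Q - 2" using UQ finQ by (subst card_Diff_subset) auto
    moreover have "card J = Suc (card ?J)" using j Suc.prems(1) by (metis card_Suc_Diff1)
    ultimately have card': "card ?Q = Suc (card ?J)"
      using W_notin finQ Suc.prems(5) by simp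
    have other: "?c' V = ?c V" if "V \<in> ?R" for V
    proof -
      have "V \<inter> (A j \<union> B j) = {}" using K_notin that by blast
      then have "V \<inter> side A B j b = {}" for b by (auto simp: side_def)
      then show ?thesis by (auto simp: block_clause_def)
    qed
    \<comment> \<open>The only literal of \<open>j\<close> in the clause of \<open>U b\<close> is
      \<open>(j, b)\<close>, which is false under \<open>s\<close>; hence any true literal there
      survives in the resolvent.\<close>
    have half: "(i, s i) \<in> ?c' ?W"
      if hit: "(i, s i) \<in> ?c (U b)" and sj: "s j = (\<not> b)" for s i b
    proof -
      obtain v where v: "v \<in> U b" "v \<in> side A B i (s i)" "i \<in> J"
        using hit by (auto simp: block_clause_def)
      have "i \<noteq> j"
      proof
        assume "i = j"
        then have "U b \<inter> side A B j (\<not> b) \<noteq> {}" using v sj by auto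
        then show False using only[OF UQ[of b], of "\<not> b" b] by simp
      qed
      moreover have "v \<notin> A j \<union> B j"
      proof
        assume "v \<in> A j \<union> B j"
        then obtain a where "v \<in> side A B j a" by (auto simp: Un_eq_sides)
        with v j have "i = j" using sides_disjoint[OF Suc.prems(3,2)] by blast
        with \<open>i \<noteq> j\<close> show False ..
      qed
      ultimately show ?thesis
        using v UX UY by (cases b) (auto simp: block_clause_def)
    qed
    \<comment> \<open>Soundness of resolution: \<open>half\<close> applies to
      \<open>U (\<not> s j)\<close>, the parent whose literal of \<open>j\<close> is false.\<close>
    have lift: "sat_by ?c' {?W} s" if both: "sat_by ?c {U True, U False} s" for s
    proof -
      have "\<exists>i. (i, s i) \<in> ?c (U b)" for b using both by (cases b) (auto simp: sat_by_def)
      then obtain i where "(i, s i) \<in> ?c (U (\<not> s j))" by blast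
      then have "(i, s i) \<in> ?c' ?W" by (rule half) simp
      then show ?thesis by (auto simp: sat_by_def)
    qed
    have mu: "min_unsat ?c' ?Q"
      unfolding min_unsat_def
    proof (intro conjI ballI notI)
      assume "\<exists>s. sat_by ?c' ?Q s"
      then obtain s where s: "sat_by ?c' ?Q s" ..
      then obtain i where "(i, s i) \<in> ?c' ?W" by (auto simp: sat_by_def)
      then obtain v where v: "v \<in> ?W" "v \<in> side A B i (s i)" "i \<in> ?J"
        by (auto simp: block_clause_def)
      then obtain b where b: "v \<in> U b" using UX UY by blast
      \<comment> \<open>The true literal of the resolvent comes from \<open>U b\<close> and keeps
        that block satisfied, so \<open>j\<close> is free to satisfy the other parent
        \<open>U (\<not> b)\<close>.\<close>
      have "sat_by ?c Q (s(j := \<not> b))"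
        unfolding sat_by_def
      proof
        fix V assume V: "V \<in> Q"
        consider "V \<in> ?R" | "V = U b" | "V = U (\<not> b)" using V by (cases b) auto
        then show "\<exists>k. (k, (s(j := \<not> b)) k) \<in> ?c V"
        proof cases
          case 1
          then obtain k where k: "(k, s k) \<in> ?c' V" using s unfolding sat_by_def by blast
          then have "k \<noteq> j" by (auto simp: block_clause_def)
          with k other[OF 1] show ?thesis by (intro exI[of _ k]) auto
        next
          case 2
          then show ?thesis using b v by (intro exI[of _ i]) (auto simp: block_clause_def)
        next
          case 3
          then show ?thesis using j side_U[of "\<not> b"] side_ne[OF j, of "\<not> b"]
            by (intro exI[of _ j]) (auto simp: block_clause_def)
        qed
      qed
      with Suc.prems(6) show False by (auto simp: min_unsat_def)
    next
      fix V assume V: "V \<in> ?Q"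
      show "\<exists>s. sat_by ?c' (?Q - {V}) s"
      proof (cases "V = ?W")
        case True
        \<comment> \<open>Deleting \<open>?W\<close> leaves \<open>?R\<close>, which is contained in
          \<open>Q - {U True}\<close>.\<close>
        obtain s where "sat_by ?c (Q - {U True}) s"
          using Suc.prems(6) UQ[of True] unfolding min_unsat_def by blast
        then have "sat_by ?c' (?Q - {V}) s" using True other unfolding sat_by_def by auto
        then show ?thesis by (rule exI[of _ s])
      next
        case False
        then have VR: "V \<in> ?R" using V by blast
        then obtain s where s: "sat_by ?c (Q - {V}) s"
          using Suc.prems(6) by (auto simp: min_unsat_def)
        then have "sat_by ?c' {?W} s"
          using VR UQ by (intro lift) (auto simp: sat_by_def)
        moreover have "sat_by ?c' (?R - {V}) s" using s other unfolding sat_by_def by auto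
        ultimately have "sat_by ?c' (?Q - {V}) s" by (auto simp: sat_by_def)
        then show ?thesis by (rule exI[of _ s])
      qed
    qed
    have "n = card ?J" using Suc.hyps(2) j by simp
    then have "derivable d (bipartite_union A B ?J, ?Q)"
      using Suc.hyps(1)[of ?J ?Q] Suc.prems(1-3) part card' mu
      by (simp add: disjoint_family_on_def)
    moreover have "join_step d (bipartite_union A B ?J, ?Q) (bipartite_union A B J, Q)"
    proof -
      have "(A j \<union> B j) \<inter> verts (bipartite_union A B ?J) = {}"
        using K_W K_notin unfolding cover'[symmetric] by blast
      moreover have "X \<inter> Y = {}" using U_disj unfolding X_def Y_def by blast
      ultimately have "join_step d (bipartite_union A B ?J, ?Q)
        (graph_union (bipartite_union A B ?J) (complete_bipartite (A j) (B j)),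
         (?Q - {?W}) \<union> {A j \<union> X, B j \<union> Y})"
        using Kj by (intro join_step.intros[of ?W]) auto
      moreover have "(?Q - {?W}) \<union> {A j \<union> X, B j \<union> Y} = Q"
        unfolding UX[symmetric] UY[symmetric] using W_notin UQ[of True] UQ[of False] by auto
      ultimately show ?thesis by (simp add: graph_union_bipartite_union j)
    qed
    ultimately show ?thesis by (rule derivable.join)
  qed
qed

section \<open>Transversals from assignments, and vertex counting\<close>

text \<open>In each block a vertex is picked on a side selected by \<open>s\<close>. An edge joins
  opposite sides of one copy, and \<open>s\<close> selects only one of them.\<close>

lemma independent_transversal_if_sat:
  assumes "\<forall>j\<in>J. Kdd_parts d (A j) (B j)" "disjoint_family_on (\<lambda>j. A j \<union> B j) J"
    and "partition_on (verts (bipartite_union A B J)) P"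
    and "sat_by (block_clause A B J) P s"
  shows "\<exists>S. independent_transversal (bipartite_union A B J) P S"
proof -
  have "\<forall>W\<in>P. \<exists>v. v \<in> W \<and> (\<exists>j\<in>J. v \<in> side A B j (s j))"
    using assms(4) by (fastforce simp: sat_by_def block_clause_def)
  then obtain v where v: "\<And>W. W \<in> P \<Longrightarrow> v W \<in> W"
    and vs: "\<And>W. W \<in> P \<Longrightarrow> \<exists>j\<in>J. v W \<in> side A B j (s j)" by metis
  have "{x, y} \<notin> edges (bipartite_union A B J)" if xy: "x \<in> v ` P" "y \<in> v ` P" for x y
  proof
    assume "{x, y} \<in> edges (bipartite_union A B J)"
    then obtain j a b where j: "j \<in> J" "a \<in> A j" "b \<in> B j" "{x, y} = {a, b}"
      by (auto simp: bipartite_union_def complete_bipartite_def)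
    then have "a \<in> v ` P" "b \<in> v ` P" using xy by (auto simp: doubleton_eq_iff)
    then obtain i k where i: "i \<in> J" "a \<in> side A B i (s i)" and k: "k \<in> J" "b \<in> side A B k (s k)"
      using vs by blast
    have "a \<in> side A B j True" "b \<in> side A B j False" using j by (auto simp: side_def)
    then have "s j = True" "s j = False" using sides_disjoint[OF assms(2,1)] i k j(1) by blast+
    then show False by simp
  qed
  moreover have "v ` P \<subseteq> verts (bipartite_union A B J)"
    using v assms(3) by (auto simp: partition_on_def)
  ultimately have "independent_transversal (bipartite_union A B J) P (v ` P)"
    using v unfolding independent_transversal_def independent_set_def by blast
  then show ?thesis ..
qed

text \<open>A minimally unsatisfiable set of \<open>k\<close> blocks meets at most \<open>k - 1\<close> copies of \<open>K\<^bsub>d,d\<^esub>\<close>, so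
  \<open>k(2d - 1) \<le> 2d(k - 1)\<close>, that is, \<open>k \<ge> 2d\<close>.\<close>

lemma min_unsat_blocks:
  assumes "1 \<le> d" "finite J" "\<forall>j\<in>J. Kdd_parts d (A j) (B j)"
    and "partition_on (verts (bipartite_union A B J)) P"
    and "card P = 2 * d" "\<forall>V\<in>P. card V = 2 * d - 1"
    and "\<nexists>s. sat_by (block_clause A B J) P s"
  shows "min_unsat (block_clause A B J) P"
proof -
  let ?c = "block_clause A B J"
  have finP: "finite P" using assms(1,5) card.infinite by fastforce
  then obtain Q where Q: "Q \<subseteq> P" "min_unsat ?c Q"
    using assms(7) by (rule min_unsat_subset_exists)
  have finQ: "finite Q" using Q finP finite_subset by blast
  \<comment> \<open>\<open>min_unsat_card\<close> requires every variable to occur, so only copies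
    met by a block of \<open>Q\<close> are counted.\<close>
  define V where "V = {j \<in> J. \<exists>b. occ ?c Q j b \<noteq> {}}"
  have finV: "finite V" using assms(2) by (simp add: V_def)
  have "\<forall>W\<in>Q. ?c W \<subseteq> V \<times> UNIV" by (auto simp: V_def occ_def block_clause_def)
  moreover have "\<forall>j\<in>V. \<exists>b. occ ?c Q j b \<noteq> {}" by (simp add: V_def)
  ultimately have lt: "card V < card Q"
    using min_unsat_card[OF finV finQ _ Q(2)] by blast
  have fin: "finite (A j \<union> B j)" and card_AB: "card (A j \<union> B j) = 2 * d" if "j \<in> J" for j
    using assms(3) that by (auto simp: Kdd_parts_def card_Un_disjoint)
  have sub: "\<Union>Q \<subseteq> (\<Union>j\<in>V. A j \<union> B j)"
  proof
    fix v assume "v \<in> \<Union>Q"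
    then obtain W where W: "W \<in> Q" "v \<in> W" by blast
    then have "v \<in> \<Union>P" using Q(1) by blast
    also have "\<Union>P = (\<Union>j\<in>J. A j \<union> B j)"
      using partition_onD1[OF assms(4)] by simp
    finally obtain j where j: "j \<in> J" "v \<in> A j \<union> B j" by blast
    then obtain b where "v \<in> side A B j b" by (auto simp: Un_eq_sides)
    then have "W \<in> occ ?c Q j b" using W j by (auto simp: occ_def block_clause_def)
    with j show "v \<in> (\<Union>j\<in>V. A j \<union> B j)" by (auto simp: V_def)
  qed
  have "card Q * (2 * d - 1) = (\<Sum>W\<in>Q. card W)" using assms(6) Q(1) by (simp add: subset_iff)
  also have "\<dots> = card (\<Union>Q)"
  proof (rule card_Union_disjoint[symmetric])
    show "disjoint Q" by (rule pairwise_subset[OF partition_onD2[OF assms(4)] Q(1)])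
    show "finite W" if "W \<in> Q" for W
      using that assms(1,6) Q(1) by (intro card_ge_0_finite) auto
  qed
  also have "\<dots> \<le> card (\<Union>j\<in>V. A j \<union> B j)"
    using sub finV fin by (intro card_mono) (auto simp: V_def)
  also have "\<dots> \<le> (\<Sum>j\<in>V. card (A j \<union> B j))" by (rule card_UN_le[OF finV])
  also have "\<dots> = card V * (2 * d)" using card_AB by (simp add: V_def)
  also have "\<dots> \<le> (card Q - 1) * (2 * d)" using lt by (intro mult_right_mono) auto
  finally have "card Q * (2 * d) - card Q \<le> card Q * (2 * d) - 2 * d"
    by (simp add: diff_mult_distrib diff_mult_distrib2)
  \<comment> \<open>These bounds ensure that neither natural-number subtraction above is truncated,
    so \<open>2 * d \<le> card Q\<close> follows.\<close>
  moreover have "2 * d \<le> card Q * (2 * d)" "card Q \<le> card Q * (2 * d)"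
    using lt assms(1) by auto
  ultimately have "card P \<le> card Q" using assms(5) by linarith
  then have "Q = P" using Q(1) finP by (intro card_seteq)
  with Q(2) show ?thesis by simp
qed

theorem corollary20:
  fixes d :: nat and G :: "'a sgraph" and P :: "'a set set"
  assumes "d \<ge> 1"
    and "disjoint_union_of_Kdd (2 * d - 1) d G"
    and "partition_on (verts G) P"
    and "card P = 2 * d"
    and "\<forall>V\<in>P. card V = 2 * d - 1"
    and "\<not> (\<exists>S. independent_transversal G P S)"
  shows "derivable d (G, P)"
proof -
  let ?J = "{..<2 * d - 1}"
  obtain A B where K: "\<forall>j\<in>?J. Kdd_parts d (A j) (B j)"
    and disj: "disjoint_family_on (\<lambda>j. A j \<union> B j) ?J" and G: "G = bipartite_union A B ?J"
    using assms(2) by (auto simp: disjoint_union_of_Kdd_def bipartite_union_def)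
  have part: "partition_on (verts (bipartite_union A B ?J)) P" using assms(3) G by simp
  have "\<nexists>s. sat_by (block_clause A B ?J) P s"
    using independent_transversal_if_sat[OF K disj part] assms(6) G by blast
  then have "min_unsat (block_clause A B ?J) P"
    using min_unsat_blocks[OF assms(1) _ K part assms(4,5)] by simp
  \<comment> \<open>By \<open>d \<ge> 1\<close>, \<open>2 * d\<close> is the successor of
    \<open>2 * d - 1\<close>, which gives the required excess of one block over the copies.\<close>
  then show ?thesis
    unfolding G using derivable_if_min_unsat[OF assms(1) _ K disj part] assms(1,4) by simp
qed

end
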